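(* Consider the single-player pile game with boundary with target $n\ge 1$ and an arbitrary finite set of choices $R=\{r_1,\dots,r_m\}\subset\mathbb{Z}$ with given transition probabilities. For $0\le s\le n$ let $B_n(k,s)$ be the probability that the game, started with $s$ chips, ends at the $k$-th turn, and let $G_{n,s}(x)=\sum_{k=0}^{\infty}B_n(k,s)x^k$. Then for every $n$ the functions $G_{n,s}(x)$, $0\le s\le n$, are rational functions of $x$ which can all be written with the same denominator, a polynomial of degree at most $n$ (with nonzero constant term). Equivalently, for fixed $n$ and $s$ the sequence $k\mapsto B_n(k,s)$ is C-finite, and the same linear recurrence relation (of order at most $n$) holds for every $s$, $0\le s\le n$ (with different initial values).
   Context: Single-player pile game with boundary: fix an integer $n\ge1$ and a finite set of integers $R=\{r_1,\dots,r_m\}$ (not necessarily positive), where $r_i$ is assigned probability $p(r_i)\ge 0$ with $\sum_i p(r_i)=1$. The player holds a nonnegative number of chips, initially $s$ with $0\le s\le n$. In each turn, independently of the past, an element $r_i\in R$ is chosen with probability $p(r_i)$, and the number of chips $c$ is replaced by $\max(0,c+r_i)$. The game ends as soon as the player has $n$ chips or more. If $s=n$ the game has ended at turn $0$, so $B_n(0,n)=1$, $B_n(k,n)=0$ for $k\ge1$, and $G_{n,n}(x)=1$. A sequence $a(k)$ is C-finite if there are $L$ and constants $c_1,\dots,c_L$ with $a(k)+c_1a(k-1)+\dots+c_La(k-L)=0$ for all sufficiently large $k$; equivalently, its generating function $\sum_k a(k)x^k$ is a rational function, with denominator $1+c_1x+\dots+c_Lx^L$. *)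

theory Defs
  imports "HOL-Probability.Probability" "HOL-Computational_Algebra.Polynomial_FPS"
begin

text \<open>
  The stream \<open>\<omega>\<close> lists the integers chosen in the successive turns.  The number of chips is
  followed for all turns, also past the end of the game; this does not affect the turn at which
  the game ends, which is the first one (counting turn \<open>0\<close>) with \<open>n\<close> or more chips.
\<close>

primrec chips :: "nat \<Rightarrow> int stream \<Rightarrow> nat \<Rightarrow> nat" where
  "chips s \<omega> 0 = s"
| "chips s \<omega> (Suc k) = nat (max 0 (int (chips s \<omega> k) + \<omega> !! k))"

definition ends_at :: "nat \<Rightarrow> nat \<Rightarrow> int stream \<Rightarrow> nat \<Rightarrow> bool" where
  "ends_at n s \<omega> k \<longleftrightarrow> n \<le> chips s \<omega> k \<and> (\<forall>j<k. chips s \<omega> j < n)"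

definition end_prob :: "int pmf \<Rightarrow> nat \<Rightarrow> nat \<Rightarrow> nat \<Rightarrow> real" where
  "end_prob P n k s = measure (stream_space (measure_pmf P)) {\<omega>. ends_at n s \<omega> k}"

definition end_gf :: "int pmf \<Rightarrow> nat \<Rightarrow> nat \<Rightarrow> real fps" where
  "end_gf P n s = Abs_fps (\<lambda>k. end_prob P n k s)"

text \<open>The truncated difference \<open>k - i\<close> is harmless: only large \<open>k\<close> matter.\<close>

definition satisfies_recurrence :: "nat \<Rightarrow> (nat \<Rightarrow> 'a::comm_ring_1) \<Rightarrow> (nat \<Rightarrow> 'a) \<Rightarrow> bool" where
  "satisfies_recurrence L c a \<longleftrightarrow>
     (\<forall>\<^sub>F k in sequentially. a k + (\<Sum>i=1..L. c i * a (k - i)) = 0)"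

definition C_finite :: "(nat \<Rightarrow> 'a::comm_ring_1) \<Rightarrow> bool" where
  "C_finite a \<longleftrightarrow> (\<exists>L c. satisfies_recurrence L c a)"

end

theory Submission imports Defs begin

text \<open>
  Conditioning on the first turn expresses the vector of the probabilities of ending at turn
  \<open>k + 1\<close> as a linear image, independent of \<open>k\<close>, of the vector for turn \<open>k\<close>.  From turn \<open>1\<close> on
  these vectors vanish at the starting positions \<open>s \<ge> n\<close>, so they lie in an \<open>n\<close>-dimensional space and
  those of the turns \<open>1, \<dots>, n + 1\<close> are linearly dependent.  Applying the linear map repeatedly
  propagates the dependence to all later turns; divided by its last nonzero coefficient
  it is the common recurrence, whose coefficients form the common denominator.
\<close>

text \<open>Gaussian elimination, by induction on the number of equations: an equation with zero
  coefficients is dropped, any other one is used to eliminate one unknown.\<close>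

lemma homogeneous_system_nontrivial_solution:
  fixes v :: "'i \<Rightarrow> nat \<Rightarrow> 'a::field"
  assumes "finite I" "m < card I"
  shows "\<exists>a. (\<exists>i\<in>I. a i \<noteq> 0) \<and> (\<forall>s<m. (\<Sum>i\<in>I. a i * v i s) = 0)"
  using assms
proof (induction m arbitrary: I v)
  case 0
  then obtain i where "i \<in> I" by fastforce
  then show ?case by (intro exI[of _ "\<lambda>_. 1"]) auto
next
  case (Suc m)
  show ?case
  proof (cases "\<forall>i\<in>I. v i m = 0")
    case True
    obtain a where "\<exists>i\<in>I. a i \<noteq> 0" "\<forall>s<m. (\<Sum>i\<in>I. a i * v i s) = 0"
      using Suc.IH[of I v] Suc.prems by auto
    with True show ?thesis by (intro exI[of _ a]) (auto simp: less_Suc_eq)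
  next
    case False
    then obtain j where j: "j \<in> I" "v j m \<noteq> 0" by auto
    define J where "J = I - {j}"
    have J: "finite J" "I = insert j J" "j \<notin> J" "m < card J"
      using Suc.prems j by (auto simp: J_def)
    obtain a where a: "\<exists>i\<in>J. a i \<noteq> 0"
      "\<forall>s<m. (\<Sum>i\<in>J. a i * (v i s - v i m / v j m * v j s)) = 0"
      using Suc.IH[of J "\<lambda>i s. v i s - v i m / v j m * v j s"] J by auto
    \<comment> \<open>The value at \<open>j\<close> comes from solving equation \<open>m\<close> for
      the unknown \<open>j\<close>.\<close>
    define b where "b = a(j := - (\<Sum>i\<in>J. a i * v i m / v j m))"
    have b: "(\<Sum>i\<in>I. b i * v i s) = (\<Sum>i\<in>J. a i * (v i s - v i m / v j m * v j s))" for s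
    proof -
      have "(\<Sum>i\<in>J. b i * v i s) = (\<Sum>i\<in>J. a i * v i s)"
        using J(3) by (intro sum.cong) (auto simp: b_def)
      then show ?thesis
        using J by (simp add: b_def sum_distrib_left sum_subtractf right_diff_distrib mult_ac)
    qed
    have "(\<Sum>i\<in>J. a i * (v i m - v i m / v j m * v j m)) = 0"
      using j by simp
    with a(2) b have "\<forall>s<Suc m. (\<Sum>i\<in>I. b i * v i s) = 0"
      by (auto simp: less_Suc_eq)
    moreover have "\<exists>i\<in>I. b i \<noteq> 0"
      using a(1) J by (auto simp: b_def)
    ultimately show ?thesis by blast
  qed
qed

text \<open>The definition of \<open>chips\<close> splits off the last turn; conditioning on the
  first turn needs the split at the head of the stream.\<close>

lemma chips_Cons: "chips s (r ## \<omega>) (Suc k) = chips (nat (max 0 (int s + r))) \<omega> k"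
  by (induction k) simp_all

lemma ends_at_0 [simp]: "ends_at n s \<omega> 0 \<longleftrightarrow> n \<le> s"
  by (simp add: ends_at_def)

lemma ends_at_Cons:
  "ends_at n s (r ## \<omega>) (Suc k) \<longleftrightarrow> s < n \<and> ends_at n (nat (max 0 (int s + r))) \<omega> k"
  by (auto simp: ends_at_def All_less_Suc2 chips_Cons simp del: chips.simps(2))

lemma measurable_chips [measurable]:
  "(\<lambda>\<omega>. chips s \<omega> k) \<in> measurable (stream_space (measure_pmf P)) (count_space UNIV)"
proof (induction k)
  case (Suc k)
  note Suc [measurable]
  have [measurable]: "(\<lambda>\<omega>. \<omega> !! k) \<in> measurable (stream_space (measure_pmf P)) (count_space UNIV)"
    using measurable_snth[of k "measure_pmf P"] by simp
  show ?case by simp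
qed simp

lemma measurable_ends_at [measurable]:
  "Measurable.pred (stream_space (measure_pmf P)) (\<lambda>\<omega>. ends_at n s \<omega> k)"
  unfolding ends_at_def by measurable

lemma space_stream_space_pmf [simp]: "space (stream_space (measure_pmf P)) = UNIV"
  by (simp add: space_stream_space)

lemma prob_space_stream_space_pmf: "prob_space (stream_space (measure_pmf P))"
  by (rule prob_space.prob_space_stream_space) (rule prob_space_measure_pmf)

lemma end_prob_0: "end_prob P n 0 s = (if n \<le> s then 1 else 0)"
  using prob_space.prob_space[OF prob_space_stream_space_pmf[of P]]
  by (simp add: end_prob_def)

text \<open>First-step analysis: the head of the stream has law \<open>P\<close> and is independent
  of the tail, which has the law of the whole stream. Finite support turns the integral into a
  sum.\<close>

lemma end_prob_Suc:
  assumes "finite (set_pmf P)"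
  shows "end_prob P n (Suc k) s =
    (if s < n then \<Sum>r\<in>set_pmf P. pmf P r * end_prob P n k (nat (max 0 (int s + r))) else 0)"
proof -
  let ?S = "stream_space (measure_pmf P)"
  interpret prob_space ?S by (rule prob_space_stream_space_pmf)
  have "emeasure ?S {\<omega>. ends_at n s \<omega> (Suc k)} =
      (\<integral>\<^sup>+r. emeasure ?S {\<omega>\<in>space ?S. r ## \<omega> \<in> {\<omega>. ends_at n s \<omega> (Suc k)}} \<partial>measure_pmf P)"
    using measurable_ends_at[of n s "Suc k" P]
    by (intro prob_space.emeasure_stream_space prob_space_measure_pmf) (simp add: pred_def)
  also have "\<dots> = (\<integral>\<^sup>+r. ennreal (if s < n then end_prob P n k (nat (max 0 (int s + r))) else 0)
      \<partial>measure_pmf P)"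
    by (intro nn_integral_cong) (auto simp: ends_at_Cons end_prob_def emeasure_eq_measure)
  also have "\<dots> = ennreal (\<Sum>r\<in>set_pmf P. pmf P r *
      (if s < n then end_prob P n k (nat (max 0 (int s + r))) else 0))"
    using assms
    by (simp add: nn_integral_measure_pmf_finite end_prob_def ennreal_mult'' mult.commute
        flip: sum_ennreal)
  finally have "end_prob P n (Suc k) s = (\<Sum>r\<in>set_pmf P. pmf P r *
      (if s < n then end_prob P n k (nat (max 0 (int s + r))) else 0))"
    by (simp add: end_prob_def emeasure_eq_measure sum_nonneg)
  then show ?thesis by auto
qed

lemma end_prob_recurrence:
  assumes "finite (set_pmf P)"
  obtains d c where "d \<le> n" "c 0 = 1"
    "\<And>k s. d < k \<Longrightarrow> (\<Sum>i\<le>d. c i * end_prob P n (k - i) s) = 0"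
proof -
  let ?e = "end_prob P n"
  \<comment> \<open>There are \<open>n + 1\<close> unknowns and \<open>n\<close> equations. Turn
    \<open>0\<close> is left out because its probability is \<open>1\<close>, not \<open>0\<close>,
    at positions \<open>s \<ge> n\<close>.\<close>
  obtain a where nz: "\<exists>i\<in>{..n}. a i \<noteq> 0"
    and a: "\<forall>s<n. (\<Sum>i\<le>n. a i * ?e (Suc i) s) = 0"
    using homogeneous_system_nontrivial_solution[of "{..n}" n "\<lambda>i s. ?e (Suc i) s"] by auto
  \<comment> \<open>The induction needs all positions at once, since the first turn may lead
    anywhere, also to \<open>n\<close> or beyond.\<close>
  have dep: "(\<Sum>i\<le>n. a i * ?e (Suc (i + k)) s) = 0" for k s
  proof (induction k arbitrary: s)
    case 0
    then show ?case
      using a by (cases "s < n") (auto simp: end_prob_Suc[OF assms])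
  next
    case (Suc k)
    show ?case
    proof (cases "s < n")
      case True
      have "(\<Sum>i\<le>n. a i * ?e (Suc (i + Suc k)) s) =
          (\<Sum>i\<le>n. \<Sum>r\<in>set_pmf P. pmf P r * (a i * ?e (Suc (i + k)) (nat (max 0 (int s + r)))))"
        using True
        by (subst end_prob_Suc[OF assms]) (simp add: sum_distrib_left mult.left_commute)
      also have "\<dots> = (\<Sum>r\<in>set_pmf P. pmf P r *
          (\<Sum>i\<le>n. a i * ?e (Suc (i + k)) (nat (max 0 (int s + r)))))"
        by (subst sum.swap) (simp add: sum_distrib_left)
      finally show ?thesis by (simp add: Suc.IH)
    next
      case False
      then show ?thesis by (simp add: end_prob_Suc[OF assms])
    qed
  qed
  \<comment> \<open>The coefficient \<open>a n\<close> may vanish, so the order of the recurrence is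
    the largest index whose coefficient can be divided by.\<close>
  define d where "d = Max {i. i \<le> n \<and> a i \<noteq> 0}"
  have fin: "finite {i. i \<le> n \<and> a i \<noteq> 0}" by simp
  have d: "d \<le> n" "a d \<noteq> 0"
    using Max_in[OF fin] nz unfolding d_def by blast+
  have top: "a i = 0" if "d < i" "i \<le> n" for i
    using Max_ge[OF fin, of i] that unfolding d_def by (metis (mono_tags) leD mem_Collect_eq)
  have "(\<Sum>i\<le>d. a (d - i) / a d * ?e (k - i) s) = 0" if "d < k" for k s
  proof -
    \<comment> \<open>Reversing the summation by \<open>i \<mapsto> d - i\<close> turns the forward
      dependence, shifted by \<open>k - Suc d\<close>, into a backward recurrence;
      \<open>d < k\<close> keeps all turns positive.\<close>
    have "(\<Sum>i\<le>d. a (d - i) / a d * ?e (k - i) s) =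
        (\<Sum>i\<le>d. a i / a d * ?e (Suc (i + (k - Suc d))) s)"
      using that by (intro sum.reindex_bij_witness[of _ "\<lambda>i. d - i" "\<lambda>i. d - i"]) (auto simp: Suc_diff_Suc)
    also have "\<dots> = (\<Sum>i\<le>d. a i * ?e (Suc (i + (k - Suc d))) s) / a d"
      by (simp add: sum_divide_distrib)
    also have "(\<Sum>i\<le>d. a i * ?e (Suc (i + (k - Suc d))) s) =
        (\<Sum>i\<le>n. a i * ?e (Suc (i + (k - Suc d))) s)"
      using d top by (intro sum.mono_neutral_left) auto
    finally show ?thesis by (simp add: dep)
  qed
  with d show thesis by (intro that[of d "\<lambda>i. a (d - i) / a d"]) auto
qed

text \<open>The product of \<open>f\<close> with the denominator has no coefficients beyond
  \<open>d\<close>, so it is itself the numerator.\<close>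

lemma fps_eq_poly_divide:
  fixes f :: "'a::field fps"
  assumes "coeff Q 0 \<noteq> 0" "\<And>k. d < k \<Longrightarrow> fps_nth (fps_of_poly Q * f) k = 0"
  shows "\<exists>N. f = fps_of_poly N / fps_of_poly Q"
proof -
  define N where "N = (\<Sum>k\<le>d. monom (fps_nth (fps_of_poly Q * f) k) k)"
  have "fps_of_poly N = fps_of_poly Q * f"
    using assms(2) by (intro fps_ext) (auto simp: N_def coeff_sum not_le)
  moreover have "fps_of_poly Q \<noteq> 0"
    using assms(1) by auto
  ultimately have "f = fps_of_poly N / fps_of_poly Q" by simp
  then show ?thesis by blast
qed

theorem theorem1:
  fixes R :: "int set" and P :: "int pmf" and n :: nat
  assumes "finite R" and "set_pmf P \<subseteq> R" and "n \<ge> 1"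
  shows "(\<exists>Q :: real poly. degree Q \<le> n \<and> coeff Q 0 \<noteq> 0 \<and>
            (\<forall>s\<le>n. \<exists>N :: real poly. end_gf P n s = fps_of_poly N / fps_of_poly Q)) \<and>
         (\<forall>s\<le>n. C_finite (\<lambda>k. end_prob P n k s)) \<and>
         (\<exists>L c. L \<le> n \<and> (\<forall>s\<le>n. satisfies_recurrence L c (\<lambda>k. end_prob P n k s)))"
proof -
  have "finite (set_pmf P)"
    using assms finite_subset by blast
  then obtain d c where d: "d \<le> n" and c0: "c 0 = 1"
    and rec: "\<And>k s. d < k \<Longrightarrow> (\<Sum>i\<le>d. c i * end_prob P n (k - i) s) = 0"
    by (rule end_prob_recurrence[where n = n]) blast
  \<comment> \<open>For \<open>k > d\<close>, the coefficient of \<open>x^k\<close> in the product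
    of \<open>Q\<close> with any of the generating functions is the left side of the
    recurrence.\<close>
  define Q where "Q = (\<Sum>i\<le>d. monom (c i) i)"
  have coeff_Q: "coeff Q i = (if i \<le> d then c i else 0)" for i
    by (simp add: Q_def coeff_sum)
  have "degree Q \<le> n"
    using d by (intro degree_le) (simp add: coeff_Q)
  moreover have "coeff Q 0 \<noteq> 0"
    by (simp add: coeff_Q c0)
  moreover have "\<exists>N. end_gf P n s = fps_of_poly N / fps_of_poly Q" for s
  proof (rule fps_eq_poly_divide)
    fix k assume "d < k"
    have "fps_nth (fps_of_poly Q * end_gf P n s) k =
        (\<Sum>i\<le>d. c i * end_prob P n (k - i) s)"
      unfolding fps_mult_nth end_gf_def using \<open>d < k\<close>
      by (intro sum.mono_neutral_cong_right) (auto simp: coeff_Q)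
    then show "fps_nth (fps_of_poly Q * end_gf P n s) k = 0"
      using rec[OF \<open>d < k\<close>] by simp
  qed fact
  moreover have sat: "satisfies_recurrence d c (\<lambda>k. end_prob P n k s)" for s
    unfolding satisfies_recurrence_def
  proof (rule eventually_sequentiallyI)
    fix k assume "Suc d \<le> k"
    \<comment> \<open>The term at \<open>0\<close>, where \<open>c 0 = 1\<close>, stands apart in
      \<open>satisfies_recurrence\<close>.\<close>
    have "{..d} = insert 0 {1..d}" by auto
    then show "end_prob P n k s + (\<Sum>i=1..d. c i * end_prob P n (k - i) s) = 0"
      using rec[of k s] \<open>Suc d \<le> k\<close> c0 by simp
  qed
  ultimately show ?thesis
    using d unfolding C_finite_def by blast
qed

end
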